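(* For all integers $n\ge 2$ and $\lambda\ge 1$, $\mathrm{cap}(n,\lambda)\le n\cdot k(n,\lambda)$. Consequently: (1) For every $n\ge 2$, $\mathrm{cap}(n,2)\le n(\lceil \log n\rceil+1) < n(\log n+2)$. (2) For every $n$ and every integer $\lambda$ with $2\le\lambda\le 0.5\log n$, $\mathrm{cap}(n,\lambda)\le n\big[\log n + (\lambda-1)\big(\log\big(\frac{\log n}{\lambda-1}\big)+4\big)\big]$. (3) For every $0<c<1/2$ and every $\lambda \ge c\,\frac{\log n}{1-H(c)}$, where $H(x)=-x\log x-(1-x)\log(1-x)$ is the binary entropy function, $\mathrm{cap}(n,\lambda)\le \frac{\lambda}{c}\, n$. (4) For every fixed positive integer $\lambda$ there are infinitely many values of $n$ such that $\mathrm{cap}(n,\lambda)\le n\big[\log n + \lfloor (\lambda-1)/2\rfloor \log\log n + 2\big]$.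
   Context: All logarithms are base $2$. For integers $n\ge 2$ and $\lambda\ge 1$, let $K_n^{\lambda}$ be the complete multigraph on vertex set $[n]=\{1,\dots,n\}$ in which every pair of distinct vertices is joined by $\lambda$ parallel edges. A bipartite covering of $K_n^{\lambda}$ is a finite collection $\mathcal H=\{H_1,\dots,H_m\}$ of bipartite graphs, each with vertex set $V(H_i)\subseteq[n]$, such that every pair of distinct vertices of $[n]$ is an edge of at least $\lambda$ of the graphs $H_i$. The capacity of $\mathcal H$ is $\sum_{i=1}^m |V(H_i)|$, and $\mathrm{cap}(n,\lambda)$ denotes the minimum capacity of a bipartite covering of $K_n^{\lambda}$. A binary code of length $k$ is a subset of $\{0,1\}^k$ (its elements are codewords); it has distance at least $\lambda$ if any two distinct codewords differ in at least $\lambda$ coordinates. $k(n,\lambda)$ denotes the minimum length of a binary code with distance at least $\lambda$ having at least $n$ codewords. *)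

theory Defs
  imports "HOL-Analysis.Analysis" "Graph_Theory.Pair_Digraph"
begin

text \<open>
  Undirected graphs are the symmetric loop-free digraphs \<^locale>\<open>pair_graph\<close> of the library:
  the edge \<open>{u, v}\<close> is present iff both arcs \<open>(u, v)\<close> and \<open>(v, u)\<close> are.
\<close>

definition bipartite :: "'a pair_pre_digraph \<Rightarrow> bool" where
  "bipartite G \<longleftrightarrow> pair_graph G \<and>
     (\<exists>A B. pverts G = A \<union> B \<and> A \<inter> B = {} \<and> parcs G \<subseteq> A \<times> B \<union> B \<times> A)"

text \<open>
  The covering is a list, i.e. an indexed family \<open>H\<^sub>1, \<dots>, H\<^sub>m\<close> in which the same graph may
  be repeated. Repetitions are needed: for \<open>n = 2\<close> only one bipartite graph contains the edge.
\<close>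

definition bipartite_covering :: "nat \<Rightarrow> nat \<Rightarrow> nat pair_pre_digraph list \<Rightarrow> bool" where
  "bipartite_covering n l Hs \<longleftrightarrow>
     (\<forall>H \<in> set Hs. bipartite H \<and> pverts H \<subseteq> {1..n}) \<and>
     (\<forall>u \<in> {1..n}. \<forall>v \<in> {1..n}. u \<noteq> v \<longrightarrow>
        l \<le> card {i. i < length Hs \<and> (u, v) \<in> parcs (Hs ! i)})"

definition capacity :: "nat pair_pre_digraph list \<Rightarrow> nat" where
  "capacity Hs = (\<Sum>i<length Hs. card (pverts (Hs ! i)))"

definition cap :: "nat \<Rightarrow> nat \<Rightarrow> nat" where
  "cap n l = (LEAST c. \<exists>Hs. bipartite_covering n l Hs \<and> capacity Hs = c)"

definition binary_code :: "nat \<Rightarrow> bool list set \<Rightarrow> bool" where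
  "binary_code k C \<longleftrightarrow> (\<forall>x \<in> C. length x = k)"

definition hamming_dist :: "bool list \<Rightarrow> bool list \<Rightarrow> nat" where
  "hamming_dist x y = card {i. i < length x \<and> x ! i \<noteq> y ! i}"

definition distance_at_least :: "nat \<Rightarrow> bool list set \<Rightarrow> bool" where
  "distance_at_least l C \<longleftrightarrow> (\<forall>x \<in> C. \<forall>y \<in> C. x \<noteq> y \<longrightarrow> l \<le> hamming_dist x y)"

definition min_code_length :: "nat \<Rightarrow> nat \<Rightarrow> nat" where
  "min_code_length n l =
     (LEAST k. \<exists>C. binary_code k C \<and> distance_at_least l C \<and> n \<le> card C)"

definition binary_entropy :: "real \<Rightarrow> real" where
  "binary_entropy x = - x * log 2 x - (1 - x) * log 2 (1 - x)"

text \<open>Both minima range over nonempty sets, so they are attained.\<close>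

lemma cap_attained: "\<exists>Hs. bipartite_covering n l Hs \<and> capacity Hs = cap n l"
proof -
  define star :: "nat \<Rightarrow> nat pair_pre_digraph" where
    "star c = \<lparr>pverts = insert c {1..n}, parcs = {c} \<times> ({1..n} - {c}) \<union> ({1..n} - {c}) \<times> {c}\<rparr>" for c
  define Hs where "Hs = map (\<lambda>t. star (Suc (t div l))) [0..<n * l]"
  have bip: "bipartite (star c)" for c
  proof -
    have "pair_graph (star c)"
      by unfold_locales (auto simp: star_def symmetric_def intro!: symI)
    then show ?thesis
      unfolding bipartite_def
      by (intro conjI exI[of _ "{c}"] exI[of _ "{1..n} - {c}"]) (auto simp: star_def)
  qed
  have cover: "l \<le> card {i. i < length Hs \<and> (u, v) \<in> parcs (Hs ! i)}"
    if "u \<in> {1..n}" "v \<in> {1..n}" "u \<noteq> v" for u v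
  proof -
    have "(\<lambda>r. (u - 1) * l + r) ` {..<l} \<subseteq> {i. i < length Hs \<and> (u, v) \<in> parcs (Hs ! i)}"
    proof (rule image_subsetI)
      fix r assume r: "r \<in> {..<l}"
      have "(u - 1) * l + r < (u - 1) * l + l" using r by simp
      also have "\<dots> = u * l" using that by (cases u) auto
      also have "\<dots> \<le> n * l" using that by simp
      finally have "(u - 1) * l + r < n * l" .
      moreover have "Suc (((u - 1) * l + r) div l) = u" using r that by auto
      ultimately show "(u - 1) * l + r \<in> {i. i < length Hs \<and> (u, v) \<in> parcs (Hs ! i)}"
        using that by (auto simp: Hs_def star_def)
    qed
    then have "card ((\<lambda>r. (u - 1) * l + r) ` {..<l}) \<le>
        card {i. i < length Hs \<and> (u, v) \<in> parcs (Hs ! i)}"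
      by (intro card_mono) auto
    then show ?thesis by (simp add: card_image inj_on_def)
  qed
  have "t div l < n" if "t < n * l" for t
    using that by (simp add: less_mult_imp_div_less)
  then have "bipartite_covering n l Hs"
    unfolding bipartite_covering_def using bip cover
    by (fastforce simp: Hs_def star_def Suc_le_eq)
  then have "\<exists>c Hs. bipartite_covering n l Hs \<and> capacity Hs = c" by blast
  then show ?thesis unfolding cap_def by (rule LeastI_ex)
qed

lemma min_code_length_attained:
  "\<exists>C. binary_code (min_code_length n l) C \<and> distance_at_least l C \<and> n \<le> card C"
proof -
  define w where "w j = map (\<lambda>t. t div Suc l = j) [0..<n * Suc l]" for j
  have dist: "l < hamming_dist (w i) (w j)" if "i < n" "i \<noteq> j" for i j
  proof -
    have "(\<lambda>r. i * Suc l + r) ` {..l} \<subseteq> {t. t < length (w i) \<and> w i ! t \<noteq> w j ! t}"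
    proof (rule image_subsetI)
      fix r assume r: "r \<in> {..l}"
      have "i * Suc l + r < Suc i * Suc l" using r by simp
      also have "\<dots> \<le> n * Suc l" using that by (intro mult_right_mono) auto
      finally have "i * Suc l + r < n * Suc l" .
      moreover have "(i * Suc l + r) div Suc l = i"
        using r by (intro div_nat_eqI) auto
      ultimately show "i * Suc l + r \<in> {t. t < length (w i) \<and> w i ! t \<noteq> w j ! t}"
        using that by (simp add: w_def del: mult_Suc_right)
    qed
    then have "card ((\<lambda>r. i * Suc l + r) ` {..l}) \<le> hamming_dist (w i) (w j)"
      unfolding hamming_dist_def by (intro card_mono) auto
    then show ?thesis by (simp add: card_image inj_on_def)
  qed
  have "inj_on w {..<n}"
    using dist by (fastforce intro!: inj_onI simp: hamming_dist_def)
  then have "n \<le> card (w ` {..<n})" by (simp add: card_image)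
  moreover have "binary_code (n * Suc l) (w ` {..<n})" by (auto simp: binary_code_def w_def)
  moreover have "distance_at_least l (w ` {..<n})"
    unfolding distance_at_least_def using dist by (metis imageE lessThan_iff order_less_imp_le)
  ultimately have "\<exists>k C. binary_code k C \<and> distance_at_least l C \<and> n \<le> card C" by blast
  then show ?thesis unfolding min_code_length_def by (rule LeastI_ex)
qed

end

theory Submission
  imports Defs "HOL-Library.Z2" "HOL-Algebra.Algebraic_Closure_Type" "HOL-Real_Asymp.Real_Asymp"
begin

text \<open>
  Each coordinate of a code with \<open>n\<close> words splits \<open>{1..n}\<close> into two classes, and the complete
  bipartite graphs between these classes form a covering. The four estimates then come from
  codes: (1) the even-weight code; (2) and (3) the Gilbert--Varshamov bound, where
  \<open>V x\<^sup>s \<le> (1 + x)\<^sup>k\<close> bounds the volume \<open>V\<close> of a ball of radius \<open>s\<close> in \<open>{0,1}\<^sup>k\<close>, with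
  \<open>x = s/k\<close> in (2) and \<open>x = c/(1 - c)\<close> in (3); (4) a nonlinear form of the extended BCH code:
  the words indexed by a field \<open>S\<close> with \<open>2\<^sup>m\<close> elements are sorted by the parity of their weight and
  the odd power sums \<open>p\<^sub>1, p\<^sub>3, \<dots>, p\<^bsub>2t-1\<^esub>\<close> of their support, and the pigeonhole principle gives a
  large class. For two words of one class, \<open>p\<^bsub>2i\<^esub> = p\<^sub>i\<^sup>2\<close> makes all of \<open>p\<^sub>0, \<dots>, p\<^bsub>2t\<^esub>\<close> vanish on the
  symmetric difference of the supports, which therefore has at least \<open>2t + 2\<close> elements.
\<close>

section \<open>Coverings from codes\<close>

text \<open>The pair \<open>u\<close>, \<open>v\<close> is an edge of the \<open>i\<close>-th graph
  exactly when the codewords of \<open>u\<close> and \<open>v\<close> differ at \<open>i\<close>, so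
  it is covered as often as their Hamming distance says. Every graph uses all \<open>n\<close>
  vertices, hence the capacity \<open>n * ?k\<close>.\<close>

lemma cap_le_mult_min_code_length: "cap n l \<le> n * min_code_length n l"
proof -
  let ?k = "min_code_length n l"
  obtain C where C: "binary_code ?k C" "distance_at_least l C" "n \<le> card C"
    using min_code_length_attained by blast
  obtain w where w: "w ` {1..n} \<subseteq> C" "inj_on w {1..n}"
  \<comment> \<open>An infinite set has \<open>card\<close> 0, so \<open>n \<le> card C\<close>
    yields finiteness of \<open>C\<close> only for positive \<open>n\<close>.\<close>
  proof (cases "n = 0")
    case True
    then show ?thesis using that by simp
  next
    case False
    then have "finite C" using C(3) card.infinite by fastforce
    then show ?thesis using that card_le_inj[of "{1..n}" C] C(3) by auto
  qed
  define H where "H i = \<lparr>pverts = {1..n},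
    parcs = {(u, v). u \<in> {1..n} \<and> v \<in> {1..n} \<and> w u ! i \<noteq> w v ! i}\<rparr>" for i
  define Hs where "Hs = map H [0..<?k]"
  have bip: "bipartite (H i)" for i
  proof -
    have "parcs (H i) \<subseteq> {1..n} \<times> {1..n}" by (auto simp: H_def)
    then have fin: "finite (parcs (H i))" by (rule finite_subset) simp
    have "pair_graph (H i)"
      by unfold_locales (use fin in \<open>auto simp: H_def symmetric_def intro!: symI\<close>)
    then show ?thesis
      unfolding bipartite_def
      by (intro conjI exI[of _ "{u \<in> {1..n}. w u ! i}"] exI[of _ "{u \<in> {1..n}. \<not> w u ! i}"])
        (auto simp: H_def)
  qed
  have cover: "l \<le> card {i. i < length Hs \<and> (u, v) \<in> parcs (Hs ! i)}"
    if "u \<in> {1..n}" "v \<in> {1..n}" "u \<noteq> v" for u v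
  proof -
    have wC: "w u \<in> C" "w v \<in> C" using that w(1) by blast+
    then have len: "length (w u) = ?k" using C(1) by (simp add: binary_code_def)
    have "w u \<noteq> w v" using w(2) that by (auto dest: inj_onD)
    then have "l \<le> hamming_dist (w u) (w v)"
      using C(2) wC by (auto simp: distance_at_least_def)
    also have "{i. i < length (w u) \<and> w u ! i \<noteq> w v ! i} =
        {i. i < length Hs \<and> (u, v) \<in> parcs (Hs ! i)}"
      using that len by (auto simp: Hs_def H_def)
    then have "hamming_dist (w u) (w v) = card {i. i < length Hs \<and> (u, v) \<in> parcs (Hs ! i)}"
      by (simp add: hamming_dist_def)
    finally show ?thesis .
  qed
  have "bipartite_covering n l Hs"
    unfolding bipartite_covering_def using bip cover by (auto simp: Hs_def H_def)
  moreover have "capacity Hs = n * ?k"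
    by (simp add: capacity_def Hs_def H_def)
  ultimately show ?thesis
    unfolding cap_def by (intro Least_le) blast
qed

text \<open>Codewords are replaced by subsets of a finite coordinate set \<open>U\<close>, and
  Hamming distance by the size of the symmetric difference. This allows coordinates that are not
  numbers, such as the elements of a field.\<close>

lemma min_code_length_le_card:
  assumes "finite U" "F \<subseteq> Pow U" "n \<le> card F"
    and dist: "\<And>A B. A \<in> F \<Longrightarrow> B \<in> F \<Longrightarrow> A \<noteq> B \<Longrightarrow> l \<le> card (sym_diff A B)"
  shows "min_code_length n l \<le> card U"
proof -
  obtain xs where xs: "set xs = U" "distinct xs"
    using finite_distinct_list[OF \<open>finite U\<close>] by blast
  then have len: "length xs = card U" by (metis distinct_card)
  define w where "w A = map (\<lambda>x. x \<in> A) xs" for A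
  have hd: "hamming_dist (w A) (w B) = card (sym_diff A B)" if "A \<in> F" "B \<in> F" for A B
  proof -
    have "sym_diff A B \<subseteq> set xs" using that assms(2) xs(1) by blast
    moreover have "sym_diff A B \<inter> set xs = (!) xs ` {i. i < length (w A) \<and> w A ! i \<noteq> w B ! i}"
      unfolding set_conv_nth by (auto simp: w_def)
    ultimately have eq: "sym_diff A B = (!) xs ` {i. i < length (w A) \<and> w A ! i \<noteq> w B ! i}"
      by blast
    have "inj_on ((!) xs) {i. i < length (w A) \<and> w A ! i \<noteq> w B ! i}"
      using xs(2) by (auto simp: w_def intro!: inj_on_nth)
    then show ?thesis
      unfolding hamming_dist_def eq by (simp add: card_image)
  qed
  have "inj_on w F"
  proof (rule inj_onI)
    fix A B assume "A \<in> F" "B \<in> F" "w A = w B"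
    then have "\<forall>x\<in>U. x \<in> A \<longleftrightarrow> x \<in> B" using xs(1) by (auto simp: w_def)
    then show "A = B" using \<open>A \<in> F\<close> \<open>B \<in> F\<close> assms(2) by blast
  qed
  then have "n \<le> card (w ` F)" using assms(3) by (simp add: card_image)
  moreover have "binary_code (card U) (w ` F)" by (auto simp: binary_code_def w_def len)
  moreover have "distance_at_least l (w ` F)"
    unfolding distance_at_least_def using dist hd by fastforce
  ultimately show ?thesis
    unfolding min_code_length_def by (intro Least_le) blast
qed

lemma cap_le_mult_card:
  assumes "finite U" "F \<subseteq> Pow U" "n \<le> card F"
    and "\<And>A B. A \<in> F \<Longrightarrow> B \<in> F \<Longrightarrow> A \<noteq> B \<Longrightarrow> l \<le> card (sym_diff A B)"
  shows "cap n l \<le> n * card U"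
proof -
  have "min_code_length n l \<le> card U"
    using assms by (intro min_code_length_le_card[of U F]) auto
  then show ?thesis
    using cap_le_mult_min_code_length[of n l] mult_le_mono2[of _ "card U" n] by (meson order_trans)
qed

text \<open>Pigeonhole: fibres that all have fewer than \<open>n\<close> elements cannot fill
  \<open>U\<close>. Nonemptiness of \<open>Y\<close> makes the comparison of sums strict.\<close>

lemma ex_large_fibre:
  assumes "finite U" "finite Y" "f ` U \<subseteq> Y" "n * card Y \<le> card U" "Y \<noteq> {}"
  shows "\<exists>y\<in>Y. n \<le> card {x \<in> U. f x = y}"
proof (rule ccontr)
  assume "\<not> ?thesis"
  then have less: "card {x \<in> U. f x = y} < n" if "y \<in> Y" for y using that by force
  have "U = (\<Union>y\<in>Y. {x \<in> U. f x = y})" using assms(3) by blast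
  then have "card U \<le> (\<Sum>y\<in>Y. card {x \<in> U. f x = y})" using card_UN_le[OF \<open>finite Y\<close>] by metis
  also have "\<dots> < (\<Sum>y\<in>Y. n)" using less assms by (intro sum_strict_mono) auto
  finally show False using assms(4) by (simp add: mult.commute)
qed

lemma even_card_sym_diff:
  assumes "finite A" "finite B" "even (card A) = even (card B)"
  shows "even (card (sym_diff A B))"
proof -
  have "card (sym_diff A B) = card (A - B) + card (B - A)"
    using assms by (intro card_Un_disjoint) auto
  moreover have "card A = card (A - B) + card (A \<inter> B)"
    by (metis Diff_disjoint Int_Diff_Un Int_commute assms(1) card_Int_Diff add.commute)
  moreover have "card B = card (B - A) + card (A \<inter> B)"
    by (metis Int_commute assms(2) card_Int_Diff add.commute)
  ultimately show ?thesis using assms(3) by presburger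
qed

section \<open>Distance two: codes of constant parity\<close>

text \<open>One of the two parity classes of subsets of the \<open>r + 1\<close> points
  \<open>{..r}\<close> has at least \<open>2 ^ r\<close> members; two distinct members have a
  nonempty symmetric difference of even size.\<close>

lemma cap_2_le:
  assumes "n \<le> 2 ^ r"
  shows "cap n 2 \<le> n * (r + 1)"
proof -
  have "2 ^ r * card (UNIV :: bool set) \<le> card (Pow {..r})" by (simp add: card_Pow)
  then obtain b where b: "2 ^ r \<le> card {A \<in> Pow {..r}. even (card A) = b}"
    using ex_large_fibre[of "Pow {..r}" "UNIV :: bool set" "\<lambda>A. even (card A)" "2 ^ r"] by auto
  have "cap n 2 \<le> n * card {..r}"
  proof (rule cap_le_mult_card)
    fix A B
    assume AB: "A \<in> {A \<in> Pow {..r}. even (card A) = b}"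
      "B \<in> {A \<in> Pow {..r}. even (card A) = b}" "A \<noteq> B"
    then have fin: "finite A" "finite B" by (auto intro: finite_subset)
    have "even (card (sym_diff A B))" using AB fin by (intro even_card_sym_diff) auto
    moreover have "card (sym_diff A B) \<noteq> 0" using AB fin by auto
    ultimately show "2 \<le> card (sym_diff A B)" by presburger
  qed (use assms b in auto)
  then show ?thesis by simp
qed

section \<open>The Gilbert-Varshamov bound\<close>

lemma card_subsets_less:
  assumes "finite U"
  shows "card {A \<in> Pow U. card A < l} = (\<Sum>i<l. card U choose i)"
proof -
  have "{A \<in> Pow U. card A < l} = (\<Union>i<l. {A. A \<subseteq> U \<and> card A = i})" by auto
  also have "card \<dots> = (\<Sum>i<l. card {A. A \<subseteq> U \<and> card A = i})"
    using assms by (intro card_UN_disjoint) auto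
  finally show ?thesis using n_subsets[OF assms] by simp
qed

text \<open>Greedy choice: the balls of radius \<open>l - 1\<close> around \<open>j < n\<close>
  chosen sets contain at most \<open>j * ?V < n * ?V \<le> 2 ^ card U\<close> sets, so some set lies
  outside all of them and can be added.\<close>

lemma gilbert_varshamov:
  assumes "finite U" "n * (\<Sum>i<l. card U choose i) \<le> 2 ^ card U" "l \<ge> 1"
  obtains F where "F \<subseteq> Pow U" "card F = n"
    "\<And>A B. A \<in> F \<Longrightarrow> B \<in> F \<Longrightarrow> A \<noteq> B \<Longrightarrow> l \<le> card (sym_diff A B)"
proof -
  let ?V = "\<Sum>i<l. card U choose i"
  have "?V \<ge> card U choose 0" using assms(3) by (intro member_le_sum) auto
  then have V: "?V > 0" by simp
  have "\<exists>F \<subseteq> Pow U. card F = j \<and> (\<forall>A\<in>F. \<forall>B\<in>F. A \<noteq> B \<longrightarrow> l \<le> card (sym_diff A B))"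
    if "j \<le> n" for j
    using that
  proof (induction j)
    case 0
    show ?case by (intro exI[of _ "{}"]) auto
  next
    case (Suc j)
    then obtain F where F: "F \<subseteq> Pow U" "card F = j"
      "\<And>A B. A \<in> F \<Longrightarrow> B \<in> F \<Longrightarrow> A \<noteq> B \<Longrightarrow> l \<le> card (sym_diff A B)"
      by (metis Suc_leD)
    have finF: "finite F" using F(1) assms(1) by (simp add: finite_subset)
    define ball where "ball A = {B \<in> Pow U. card (sym_diff A B) < l}" for A
    have card_ball: "card (ball A) \<le> ?V" if "A \<in> F" for A
    proof -
      \<comment> \<open>Symmetric difference with \<open>A\<close> is injective and moves the ball
        to one centred at the empty set.\<close>
      have "card (ball A) = card (sym_diff A ` ball A)"
        by (rule card_image[symmetric]) (auto intro!: inj_onI)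
      also have "\<dots> \<le> card {B \<in> Pow U. card B < l}"
        using that F(1) assms(1) by (intro card_mono) (auto simp: ball_def)
      finally show ?thesis using card_subsets_less[OF assms(1)] by simp
    qed
    have "card (\<Union>(ball ` F)) \<le> (\<Sum>A\<in>F. card (ball A))" using finF by (rule card_UN_le)
    also have "\<dots> \<le> j * ?V" using sum_bounded_above[of F "\<lambda>A. card (ball A)" ?V] card_ball F(2) by simp
    also have "\<dots> < n * ?V" using Suc.prems V by simp
    finally have "card (\<Union>(ball ` F)) < card (Pow U)" using assms by (simp add: card_Pow)
    moreover have "\<Union>(ball ` F) \<subseteq> Pow U" by (auto simp: ball_def)
    ultimately obtain B where B: "B \<in> Pow U" "\<And>A. A \<in> F \<Longrightarrow> B \<notin> ball A"
      by (metis UN_I less_irrefl subsetI subset_antisym)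
    have far: "l \<le> card (sym_diff A B)" "l \<le> card (sym_diff B A)" if "A \<in> F" for A
      using B that by (force simp: ball_def Un_commute)+
    \<comment> \<open>A member of \<open>F\<close> would be at distance 0 from itself, against
      \<open>l \<ge> 1\<close>.\<close>
    have "B \<notin> F" using far assms(3) by force
    then show ?case
      using F far B(1) finF by (intro exI[of _ "insert B F"]) auto
  qed
  then show ?thesis using that by (metis order_refl)
qed

lemma cap_le_gilbert_varshamov:
  assumes "real n * real (\<Sum>i<l. k choose i) \<le> 2 ^ k" "l \<ge> 1"
  shows "cap n l \<le> n * k"
proof -
  have "real (n * (\<Sum>i<l. card {..<k} choose i)) \<le> real (2 ^ card {..<k})"
    using assms(1) by simp
  then have "n * (\<Sum>i<l. card {..<k} choose i) \<le> 2 ^ card {..<k}"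
    unfolding of_nat_le_iff .
  from gilbert_varshamov[OF _ this \<open>l \<ge> 1\<close>] obtain F where "F \<subseteq> Pow {..<k}" "card F = n"
    "\<And>A B. A \<in> F \<Longrightarrow> B \<in> F \<Longrightarrow> A \<noteq> B \<Longrightarrow> l \<le> card (sym_diff A B)" by blast
  then show ?thesis using cap_le_mult_card[of "{..<k}" F n l] by simp
qed

text \<open>For \<open>i \<le> s\<close> the factor \<open>x ^ s\<close> is at most
  \<open>x ^ i\<close>, and the resulting sum is part of the binomial expansion of
  \<open>(1 + x) ^ k\<close>.\<close>

lemma sum_choose_mult_power_le:
  fixes x :: real
  assumes "0 \<le> x" "x \<le> 1"
  shows "(\<Sum>i\<le>s. real (k choose i)) * x ^ s \<le> (1 + x) ^ k"
proof -
  have "(\<Sum>i\<le>s. real (k choose i)) * x ^ s \<le> (\<Sum>i\<le>s. real (k choose i) * x ^ i)"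
    unfolding sum_distrib_right using assms
    by (intro sum_mono mult_left_mono power_decreasing) auto
  \<comment> \<open>Since \<open>s\<close> may exceed \<open>k\<close>, the sum is extended to
    \<open>max s k\<close>; the terms beyond \<open>k\<close> vanish.\<close>
  also have "\<dots> \<le> (\<Sum>i\<le>max s k. real (k choose i) * x ^ i)"
    using assms by (intro sum_mono2) auto
  also have "\<dots> = (\<Sum>i\<le>k. real (k choose i) * x ^ i)"
    by (intro sum.mono_neutral_right) auto
  also have "\<dots> = (1 + x) ^ k"
    by (subst binomial_ring[of x 1 k, folded add.commute[of 1 x]]) (simp add: mult.commute)
  finally show ?thesis .
qed

section \<open>Inequalities for logarithms and entropy\<close>

text \<open>Both sides agree at 2. The tangent of \<open>ln\<close> there has slope 1/2, less than
  the slope \<open>ln 2\<close> of the line \<open>(x - 1) * ln 2\<close>.\<close>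

lemma log2_le_minus_one:
  assumes "x \<ge> 2"
  shows "log 2 x \<le> x - 1"
proof -
  have "ln x = ln 2 + ln (x / 2)" using assms by (simp add: ln_div)
  also have "ln (x / 2) \<le> x / 2 - 1" using assms by (intro ln_le_minus_one) auto
  also have "x / 2 - 1 = (x - 2) * (1 / 2)" by simp
  also have "\<dots> \<le> (x - 2) * ln 2"
    using assms ln2_ge_two_thirds by (intro mult_left_mono) auto
  also have "ln 2 + (x - 2) * ln 2 = (x - 1) * ln 2" by (simp add: algebra_simps)
  finally have "ln x \<le> (x - 1) * ln 2" by simp
  then show ?thesis by (simp add: log_def divide_le_eq)
qed

text \<open>Bernoulli's inequality; it absorbs a factor 2 lost by rounding into a
  \<open>d\<close>-th power.\<close>

lemma two_le_one_plus_inverse_power: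
  assumes "d \<ge> 1"
  shows "2 \<le> (1 + 1 / real d) ^ d"
  using Bernoulli_inequality[of "1 / real d" d] assms order_trans[of "-1" 0 "1 / real d"] by simp

text \<open>The relative entropy to the fair coin is positive: \<open>ln y \<le> y - 1\<close> is
  applied at \<open>1 / (2 * c)\<close> and \<open>1 / (2 * (1 - c))\<close>, the weighted right
  sides add up to 0, and the first bound is strict as \<open>c\<close> is not 1/2.\<close>

lemma binary_entropy_less_one:
  assumes "0 < c" "c < 1 / 2"
  shows "binary_entropy c < 1"
proof -
  have 1: "ln (1 / (2 * c)) < 1 / (2 * c) - 1"
    using ln_le_minus_one[of "1 / (2 * c)"] ln_eq_minus_one[of "1 / (2 * c)"] assms
    by (force simp: field_simps)
  have 2: "ln (1 / (2 * (1 - c))) \<le> 1 / (2 * (1 - c)) - 1"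
    using ln_le_minus_one[of "1 / (2 * (1 - c))"] assms by simp
  have "c * ln (1 / (2 * c)) < c * (1 / (2 * c) - 1)"
    using 1 assms by (intro mult_strict_left_mono) auto
  also have "\<dots> = 1 / 2 - c" using assms by (simp add: field_simps)
  finally have 3: "c * ln (1 / (2 * c)) < 1 / 2 - c" .
  have "(1 - c) * ln (1 / (2 * (1 - c))) \<le> (1 - c) * (1 / (2 * (1 - c)) - 1)"
    using 2 assms by (intro mult_left_mono) auto
  also have "\<dots> = c - 1 / 2" using assms by (simp add: field_simps)
  finally have 4: "(1 - c) * ln (1 / (2 * (1 - c))) \<le> c - 1 / 2" .
  have "ln (1 / (2 * c)) = - ln 2 - ln c" "ln (1 / (2 * (1 - c))) = - ln 2 - ln (1 - c)"
    using assms ln_mult[of 2 "1 - c"] ln_mult[of 2 c] by (simp_all add: ln_div)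
  with 3 4 have "c * (- ln 2 - ln c) < 1 / 2 - c" "(1 - c) * (- ln 2 - ln (1 - c)) \<le> c - 1 / 2"
    by simp_all
  then have "- c * ln c - (1 - c) * ln (1 - c) < ln 2"
    by (simp add: algebra_simps)
  then have "(- c * ln c - (1 - c) * ln (1 - c)) / ln 2 < 1" by simp
  then show ?thesis by (simp add: binary_entropy_def log_def diff_divide_distrib)
qed

section \<open>Fields of characteristic 2 and power sums\<close>

text \<open>The polynomial \<open>x ^ 2 ^ m - x\<close> splits over an algebraically closed field,
  and its derivative \<open>-1\<close> rules out repeated roots, so it has as many roots as its
  degree. They form the field with \<open>2 ^ m\<close> elements.\<close>

lemma card_frobenius_fixed:
  assumes "CHAR('a :: alg_closed_field) = 2" "m > 0"
  shows "card {x :: 'a. x ^ 2 ^ m = x} = 2 ^ m"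
proof -
  let ?p = "Polynomial.monom 1 (2 ^ m) - Polynomial.monom 1 1 :: 'a poly"
  have two: "(2 :: 'a) = 0"
    using of_nat_CHAR[where 'a = 'a] assms(1) by simp
  have m: "1 < (2 :: nat) ^ m" using assms(2) by (intro one_less_power) auto
  have deg: "Polynomial.degree ?p = 2 ^ m"
    using m degree_add_eq_left[of "- Polynomial.monom 1 1" "Polynomial.monom 1 (2 ^ m) :: 'a poly"]
    by (simp add: degree_monom_eq)
  have nz: "?p \<noteq> 0" using deg m by (metis degree_0 not_one_less_zero)
  obtain A c where A: "size A = 2 ^ m" "?p = Polynomial.smult c (\<Prod>x\<in>#A. [:-x, 1:])" "c \<noteq> 0"
    using alg_closed_imp_factorization[OF nz] deg nz leading_coeff_0_iff by metis
  \<comment> \<open>As \<open>m > 0\<close>, the factor \<open>2 ^ m\<close> from differentiating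
    the leading term is zero in characteristic 2.\<close>
  have deriv: "pderiv ?p = -1"
    using assms(2) two by (simp add: pderiv_diff pderiv_monom power_0_left)
  have count: "count A x \<le> 1" for x
  proof (rule ccontr)
    assume "\<not> count A x \<le> 1"
    then have "{#x, x#} \<subseteq># A" by (auto simp: subseteq_mset_def)
    then obtain B where "A = {#x, x#} + B" by (metis mset_subset_eq_exists_conv)
    then obtain q where q: "?p = [:-x, 1:] * ([:-x, 1:] * q)"
      using A(2) by (metis (no_types, lifting) mult_smult_right prod_mset.add_mset
          image_mset_add_mset add_mset_add_single union_mset_add_mset_left empty_neutral(1))
    have "poly (pderiv ?p) x = 0" unfolding q by (simp add: pderiv_mult del: mult_pCons_left mult_pCons_right)
    then show False unfolding deriv by simp
  qed
  have "A = mset_set (set_mset A)"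
  proof (rule multiset_eqI)
    fix x show "count A x = count (mset_set (set_mset A)) x"
      using count[of x] by (cases "x \<in># A") (auto simp: not_in_iff Suc_le_eq dest: le_antisym)
  qed
  then have "card (set_mset A) = 2 ^ m" using A(1) by (metis size_mset_set)
  moreover have "x ^ 2 ^ m = x \<longleftrightarrow> x \<in># A" for x
  proof -
    have "x ^ 2 ^ m = x \<longleftrightarrow> poly ?p x = 0" by (simp add: poly_monom)
    also have "\<dots> \<longleftrightarrow> poly (Polynomial.smult c (\<Prod>x\<in>#A. [:-x, 1:])) x = 0"
      using A(2) by simp
    also have "\<dots> \<longleftrightarrow> x \<in># A" using A(3) by (auto simp: poly_prod_mset prod_mset_zero_iff)
    finally show ?thesis .
  qed
  ultimately show ?thesis by simp
qed

text \<open>Summing the polynomial that vanishes on all of \<open>A\<close> but one point isolates that point.\<close>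

lemma less_card_if_power_sums_zero:
  fixes A :: "'a :: field set"
  assumes "finite A" "A \<noteq> {}" "\<And>j. j < w \<Longrightarrow> (\<Sum>a\<in>A. a ^ j) = 0"
  shows "w < card A"
proof (rule ccontr)
  assume "\<not> w < card A"
  obtain a0 where a0: "a0 \<in> A" using assms(2) by blast
  define f where "f = (\<Prod>b\<in>A - {a0}. [:-b, 1:])"
  have "Polynomial.degree f = card (A - {a0})"
    unfolding f_def by (subst degree_prod_eq_sum_degree) auto
  \<comment> \<open>The degree is \<open>card A - 1\<close>, so only power sums assumed to vanish
    occur below.\<close>
  then have deg: "Polynomial.degree f < w"
    using a0 assms(1) \<open>\<not> w < card A\<close> card_gt_0_iff[of A] by auto
  have "(\<Sum>a\<in>A. poly f a) = (\<Sum>i\<le>Polynomial.degree f. Polynomial.coeff f i * (\<Sum>a\<in>A. a ^ i))"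
    unfolding poly_altdef by (subst sum.swap) (simp add: sum_distrib_left)
  also have "\<dots> = 0" using assms(3) deg by (intro sum.neutral) auto
  finally have "(\<Sum>a\<in>A. poly f a) = 0" .
  moreover have "(\<Sum>a\<in>A. poly f a) = poly f a0"
    using a0 assms(1) by (subst sum.remove[of A a0]) (auto simp: f_def poly_prod intro!: sum.neutral)
  moreover have "poly f a0 \<noteq> 0" using assms(1) by (auto simp: f_def poly_prod)
  ultimately show False by simp
qed

text \<open>Strong induction: the exponent 0 is the parity of \<open>card A\<close>, odd exponents
  are assumed, and the power sum for \<open>2 * i\<close> is the square of the one for
  \<open>i\<close>, squaring being additive in characteristic 2.\<close>

lemma power_sums_zero_if_odd_power_sums_zero:
  fixes A :: "'a :: field set"
  assumes char: "CHAR('a) = 2" and "even (card A)"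
    and odd: "\<And>i. i < t \<Longrightarrow> (\<Sum>a\<in>A. a ^ (2 * i + 1)) = 0"
  shows "j < 2 * t + 1 \<Longrightarrow> (\<Sum>a\<in>A. a ^ j) = 0"
proof (induction j rule: less_induct)
  case (less j)
  consider "j = 0" | i where "j = 2 * i" "i > 0" | i where "j = 2 * i + 1"
    by (cases "j = 0"; cases "even j") (auto elim!: evenE oddE)
  then show ?case
  proof cases
    case 1
    have "of_nat (card A) = (0 :: 'a)"
      unfolding of_nat_eq_0_iff_char_dvd char by (rule assms(2))
    then show ?thesis using 1 by simp
  next
    case 2
    have "(\<Sum>a\<in>A. a ^ j) = (\<Sum>a\<in>A. a ^ i) ^ 2"
      unfolding 2 power_even_eq by (rule freshmans_dream_sum[symmetric]) (simp_all add: char)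
    also have "(\<Sum>a\<in>A. a ^ i) = 0" using less.prems 2 by (intro less.IH) auto
    finally show ?thesis by simp
  next
    case 3
    then show ?thesis using odd[of i] less.prems by simp
  qed
qed

text \<open>After cancelling \<open>A \<inter> B\<close>, the sums over \<open>A - B\<close> and
  \<open>B - A\<close> agree, and their total is twice one of them.\<close>

lemma sum_sym_diff_char_2:
  fixes g :: "'b \<Rightarrow> 'a :: field"
  assumes "CHAR('a) = 2" "finite A" "finite B" "sum g A = sum g B"
  shows "sum g (sym_diff A B) = 0"
proof -
  have two: "(2 :: 'a) = 0"
    using of_nat_CHAR[where 'a = 'a] assms(1) by simp
  have "sum g (sym_diff A B) = sum g (A - B) + sum g (B - A)"
    using assms by (intro sum.union_disjoint) auto
  moreover have "sum g A = sum g (A \<inter> B) + sum g (A - B)"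
    using assms by (intro sum.Int_Diff) auto
  moreover have "sum g B = sum g (A \<inter> B) + sum g (B - A)"
    using assms by (subst Int_commute, intro sum.Int_Diff) auto
  ultimately have "sum g (sym_diff A B) = 2 * sum g (A - B)"
    using assms(4) by simp
  then show ?thesis using two by simp
qed

section \<open>Asymptotic and numerical inequalities\<close>

text \<open>For \<open>r = 2 ^ m - 1 - m * t\<close>, the logarithm of the BCH code size,
  \<open>log 2 r\<close> differs from \<open>m\<close> by a null sequence. So the redundancy
  \<open>1 + m * t\<close> is eventually at most \<open>t * log 2 r + 2\<close>.\<close>

lemma eventually_bch_length:
  fixes t :: nat
  shows "eventually (\<lambda>m. 1 + real m * real t \<le> real t * log 2 (2 ^ m - 1 - real m * real t) + 2) at_top"
proof -
  have "((\<lambda>m. real m - log 2 (2 ^ m - 1 - real m * real t)) \<longlongrightarrow> 0) at_top"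
  proof (cases "t = 0")
    case True
    then show ?thesis by simp real_asymp
  next
    case False
    then have "real t > 0" by simp
    then show ?thesis by real_asymp
  qed
  then have "((\<lambda>m. real t * (real m - log 2 (2 ^ m - 1 - real m * real t))) \<longlongrightarrow> 0) at_top"
    by (rule tendsto_mult_right_zero)
  then have "eventually (\<lambda>m. real t * (real m - log 2 (2 ^ m - 1 - real m * real t)) < 1) at_top"
    by (rule order_tendstoD) simp
  then show ?thesis by eventually_elim (simp add: algebra_simps)
qed

text \<open>The quadratic bound on \<open>exp\<close> gives only 3 at 1; applied at 1/8 and raised
  to the eighth power it gives about 2.87.\<close>

lemma exp_one_less: "exp 1 < (29 / 10 :: real)"
proof -
  have "exp 1 = exp (1 / 8 :: real) ^ 8" by (simp flip: exp_of_nat_mult)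
  also have "\<dots> \<le> (1 + 1 / 8 + (1 / 8)\<^sup>2) ^ 8"
    by (intro power_mono exp_bound) auto
  also have "\<dots> < 29 / 10" by (simp add: power2_eq_square eval_nat_numeral)
  finally show ?thesis .
qed

text \<open>Here 16 is \<open>2 ^ 4\<close>, from the summand 4 in the bound for small distance. The
  estimates below give \<open>(11.6 + 4.35) * x = 15.95 * x\<close>; with 3 in place of 2.9 they
  would exceed \<open>16 * x\<close>.\<close>

lemma gilbert_varshamov_margin:
  fixes d x :: real
  assumes "d \<ge> 1" "x \<ge> 2 * (1 + 1 / d)"
  shows "(1 + 1 / d) * exp 1 * (x + log 2 x + 4) \<le> 16 * x"
proof -
  define s where "s = 1 + 1 / d"
  have s: "1 \<le> s" "s \<le> 2" "2 * s \<le> x" using assms by (auto simp: s_def)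
  have e: "s * exp 1 \<le> s * (29 / 10)" using s exp_one_less by (intro mult_left_mono) auto
  have "s * exp 1 * (x + log 2 x + 4) \<le> s * exp 1 * (2 * x + 3)"
    using log2_le_minus_one[of x] s by (intro mult_left_mono) auto
  also have "\<dots> \<le> s * (29 / 10) * (2 * x + 3)"
    using e s by (intro mult_right_mono) auto
  also have "\<dots> = (29 / 5) * (s * x) + (87 / 10) * s" by (simp add: algebra_simps)
  also have "s * x \<le> 2 * x" using s by (intro mult_right_mono) auto
  also have "(29 / 5) * (2 * x) + (87 / 10) * s \<le> 16 * x" using s by simp
  finally show ?thesis by (simp add: s_def)
qed

section \<open>Small and large distance via Gilbert-Varshamov\<close>

lemma cap_le_small_distance:
  assumes "n \<ge> 2" "2 \<le> l" "real l \<le> 0.5 * log 2 (real n)"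
  shows "real (cap n l) \<le> real n * (log 2 (real n)
    + (real l - 1) * (log 2 (log 2 (real n) / (real l - 1)) + 4))"
proof -
  define L where "L = log 2 (real n)"
  define d where "d = l - 1"
  have l: "l = Suc d" and d: "d \<ge> 1"
    using assms(2) by (auto simp: d_def)
  then have rd: "real l - 1 = real d" by simp
  define x where "x = L / real d"
  define y where "y = L + real d * (log 2 x + 4)"
  define k where "k = nat \<lfloor>y\<rfloor>"
  \<comment> \<open>This is the hypothesis on \<open>l\<close>; divided by \<open>d\<close>, it is
    the lower bound on \<open>x\<close> that the margin lemma requires.\<close>
  have "2 * (real d + 1) \<le> L" using assms(3) l by (simp add: L_def)
  then have "2 * (real d + 1) / real d \<le> x"
    unfolding x_def by (intro divide_right_mono) auto
  moreover have "2 * (real d + 1) / real d = 2 * (1 + 1 / real d)"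
    using d by (simp add: add_divide_distrib)
  ultimately have x: "2 * (1 + 1 / real d) \<le> x" by simp
  have "2 \<le> 2 * (1 + 1 / real d)" by simp
  then have x2: "2 \<le> x" using x by (rule order_trans)
  have logx: "log 2 x \<ge> 0" using x2 by simp
  have L: "L = x * real d" using d by (simp add: x_def)
  have y: "y = real d * (x + log 2 x + 4)" by (simp add: y_def L algebra_simps)
  have "real d * 1 \<le> y" unfolding y using x2 logx by (intro mult_left_mono) auto
  then have dy: "real d \<le> y" by simp
  then have k: "real k \<le> y" "y < real k + 1" "d \<le> k"
    using floor_correct[of y] of_nat_0_le_iff[of d] unfolding k_def by linarith+
  define V where "V = (\<Sum>i\<le>d. real (k choose i))"
  have V0: "V \<ge> 0" by (simp add: V_def sum_nonneg)
  \<comment> \<open>This choice gives \<open>(1 + a) ^ k \<le> exp (real d)\<close>, hence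
    \<open>V \<le> (exp 1 * k / d) ^ d\<close>.\<close>
  define a where "a = real d / real k"
  have k0: "real k > 0" using k d by simp
  have a: "0 < a" "a \<le> 1" using k d k0 by (auto simp: a_def)
  have "V * a ^ d \<le> (1 + a) ^ k"
    unfolding V_def using a by (intro sum_choose_mult_power_le) auto
  also have "\<dots> \<le> exp a ^ k" using a by (intro power_mono) auto
  also have "\<dots> = exp (real d)" using k0 by (simp add: a_def flip: exp_of_nat_mult)
  also have "\<dots> = exp 1 ^ d" by (simp flip: exp_of_nat_mult)
  finally have "V \<le> exp 1 ^ d / a ^ d" using a by (simp add: pos_le_divide_eq)
  also have "\<dots> = (exp 1 * (real k / real d)) ^ d"
    by (simp add: a_def power_divide power_mult_distrib)
  also have "\<dots> \<le> (exp 1 * (x + log 2 x + 4)) ^ d"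
    using k(1) d unfolding y
    by (intro power_mono mult_left_mono) (auto simp: pos_divide_le_eq mult.commute)
  finally have V: "V \<le> (exp 1 * (x + log 2 x + 4)) ^ d" .
  \<comment> \<open>Rounding \<open>y\<close> down to \<open>k\<close> costs a factor of at most 2,
    which the leading 2 pays for.\<close>
  have "2 * V \<le> (1 + 1 / real d) ^ d * (exp 1 * (x + log 2 x + 4)) ^ d"
    using V two_le_one_plus_inverse_power[OF d] V0 by (intro mult_mono) auto
  also have "\<dots> = ((1 + 1 / real d) * exp 1 * (x + log 2 x + 4)) ^ d"
    by (simp only: power_mult_distrib mult.assoc)
  also have "\<dots> \<le> (16 * x) ^ d"
    using gilbert_varshamov_margin[of "real d" x] d x x2 logx by (intro power_mono) auto
  also have "\<dots> = 2 powr (real d * (log 2 x + 4))"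
  proof -
    have "16 * x = 2 powr (log 2 x + 4)" using x2 by (simp add: powr_add)
    then show ?thesis by (simp add: powr_powr mult.commute flip: powr_realpow)
  qed
  finally have V2: "2 * V \<le> 2 powr (real d * (log 2 x + 4))" .
  have n: "real n = 2 powr L" using assms(1) by (simp add: L_def)
  have "2 * (real n * V) = real n * (2 * V)" by simp
  also have "\<dots> \<le> 2 powr L * 2 powr (real d * (log 2 x + 4))"
    unfolding n using V2 by (intro mult_left_mono) auto
  also have "\<dots> = 2 powr y" by (simp add: y_def powr_add)
  also have "\<dots> \<le> 2 powr (real k + 1)" using k by simp
  also have "\<dots> = 2 * 2 ^ k" by (simp add: powr_add powr_realpow)
  finally have "real n * V \<le> 2 ^ k" by simp
  then have "real n * real (\<Sum>i<l. k choose i) \<le> 2 ^ k"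
    by (simp add: V_def l lessThan_Suc_atMost)
  then have "cap n l \<le> n * k" using assms(2) by (intro cap_le_gilbert_varshamov) auto
  then have "real (cap n l) \<le> real (n * k)" by (rule of_nat_mono)
  also have "\<dots> \<le> real n * y" using k(1) by (simp add: mult_left_mono)
  finally show ?thesis unfolding y_def x_def L_def rd .
qed

text \<open>Without rounding, \<open>x = c / (1 - c)\<close> gives \<open>(1 + x) powr K / x powr (c
  * K) = 2 powr (K * binary_entropy c)\<close>, and the hypothesis says
  \<open>log 2 n \<le> K * (1 - binary_entropy c)\<close>.\<close>

lemma cap_le_large_distance:
  assumes c: "0 < c" "c < 1 / 2" and "n \<ge> 2" "l \<ge> 1"
    and l: "real l \<ge> c * (log 2 (real n) / (1 - binary_entropy c))"
  shows "real (cap n l) \<le> real l / c * real n"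
proof -
  define L where "L = log 2 (real n)"
  define K where "K = real l / c"
  define k where "k = nat \<lfloor>K\<rfloor>"
  define a b where "a = log 2 c" and "b = log 2 (1 - c)"
  have H: "1 - binary_entropy c = 1 + c * a + (1 - c) * b"
    by (simp add: binary_entropy_def a_def b_def)
  have "L / (1 - binary_entropy c) \<le> K"
    using l c by (simp add: K_def L_def field_simps)
  then have L: "L \<le> K * (1 + c * a + (1 - c) * b)"
    using binary_entropy_less_one[OF c] unfolding H[symmetric] by (simp add: pos_divide_le_eq)
  have cK: "c * K = real l" using c by (simp add: K_def)
  have "K \<ge> 0" using c by (simp add: K_def)
  then have k: "real k \<le> K" "K < real k + 1"
    using floor_correct[of K] unfolding k_def by auto
  have a: "a \<le> -1"
  proof -
    have "log 2 c \<le> log 2 (1 / 2)" using c by (subst log_le_cancel_iff) auto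
    then show ?thesis by (simp add: a_def log_divide)
  qed
  have b: "b \<ge> -1"
  proof -
    have "log 2 (1 / 2) \<le> log 2 (1 - c)" using c by (subst log_le_cancel_iff) auto
    then show ?thesis by (simp add: b_def log_divide)
  qed
  define V where "V = (\<Sum>i\<le>l - 1. real (k choose i))"
  have "real (k choose 0) \<le> V" unfolding V_def by (intro member_le_sum) auto
  then have V: "V > 0" by simp
  define x where "x = c / (1 - c)"
  have x: "0 < x" "x \<le> 1" using c by (auto simp: x_def)
  have logx: "log 2 x = a - b" using c by (simp add: x_def a_def b_def log_divide)
  have "1 + x = 1 / (1 - c)" using c by (simp add: x_def field_simps)
  then have log1x: "log 2 (1 + x) = - b" using c by (simp add: b_def log_divide)
  have "V * x ^ (l - 1) \<le> (1 + x) ^ k"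
    unfolding V_def using x by (intro sum_choose_mult_power_le) auto
  then have "log 2 (V * x ^ (l - 1)) \<le> log 2 ((1 + x) ^ k)"
    using x V by (subst log_le_cancel_iff) auto
  then have "log 2 V + (real l - 1) * (a - b) \<le> - real k * b"
    using x V \<open>l \<ge> 1\<close> by (simp add: log_mult log_nat_power logx log1x of_nat_diff)
  then have "L + log 2 V \<le> K * (1 + c * a + (1 - c) * b) - (real l - 1) * (a - b) - real k * b"
    using L by simp
  \<comment> \<open>Rounding down to \<open>k\<close> loses at most \<open>1 + b\<close>; radius
    \<open>l - 1\<close> instead of \<open>l\<close> contributes \<open>a - b\<close>. Together this
    is at most \<open>1 + a \<le> 0\<close>, by \<open>c < 1 / 2\<close>.\<close>
  also have "\<dots> = real k + ((K - real k) * (1 + b) + (a - b))"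
    unfolding cK[symmetric] by (simp add: algebra_simps)
  also have "(K - real k) * (1 + b) \<le> 1 * (1 + b)"
    using k b by (intro mult_right_mono) auto
  also have "real k + (1 * (1 + b) + (a - b)) \<le> real k" using a by simp
  finally have "L + log 2 V \<le> real k" by simp
  then have "2 powr (L + log 2 V) \<le> 2 powr real k" by simp
  then have "real n * V \<le> 2 ^ k"
    using V \<open>n \<ge> 2\<close> by (simp add: L_def powr_add powr_realpow)
  moreover have "{..l - 1} = {..<l}" using \<open>l \<ge> 1\<close> by auto
  ultimately have "real n * real (\<Sum>i<l. k choose i) \<le> 2 ^ k"
    by (simp add: V_def)
  then have "cap n l \<le> n * k" using \<open>l \<ge> 1\<close> by (intro cap_le_gilbert_varshamov) auto
  then have "real (cap n l) \<le> real (n * k)" by (rule of_nat_mono)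
  also have "\<dots> \<le> real n * K" using k(1) by (simp add: mult_left_mono)
  finally show ?thesis by (simp add: K_def mult.commute)
qed

section \<open>The extended BCH code and fixed distance\<close>

lemma cap_le_bch:
  assumes "m > 0" "1 + m * t \<le> 2 ^ m"
  shows "cap (2 ^ (2 ^ m - (1 + m * t))) (2 * t + 2) \<le> 2 ^ (2 ^ m - (1 + m * t)) * 2 ^ m"
proof -
  \<comment> \<open>The field with \<open>2 ^ m\<close> elements, taken inside an algebraic closure
    of the two-element field.\<close>
  define S :: "bit alg_closure set" where "S = {x. x ^ 2 ^ m = x}"
  have "CHAR(bit) = 2"
  proof (rule CHAR_eqI)
    show "2 dvd n" if "of_nat n = (0 :: bit)" for n
      using that even_of_nat_iff[of n, where 'a = bit] by simp
  qed simp
  then have char: "CHAR(bit alg_closure) = 2" by simp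
  have card_S: "card S = 2 ^ m" unfolding S_def using char assms(1) by (rule card_frobenius_fixed)
  then have fin_S: "finite S" by (intro card_ge_0_finite) simp
  define P where "P A i = (\<Sum>a\<in>A. a ^ (2 * i + 1))" for A :: "bit alg_closure set" and i
  \<comment> \<open>\<open>f\<close> plays the role of the syndrome; \<open>restrict\<close> keeps
    its values in a finite set, of size \<open>2 ^ (1 + m * t)\<close>.\<close>
  define f where "f A = (even (card A), restrict (P A) {..<t})" for A :: "bit alg_closure set"
  define Y where "Y = (UNIV :: bool set) \<times> (\<Pi>\<^sub>E i\<in>{..<t}. S)"
  let ?n = "2 ^ (2 ^ m - (1 + m * t))"
  have P_in: "P A i \<in> S" if "A \<subseteq> S" for A i
  proof -
    \<comment> \<open>Raising to the power \<open>2 ^ m\<close> is additive in characteristic 2, so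
      power sums of elements of \<open>S\<close> stay in \<open>S\<close>.\<close>
    have "P A i ^ 2 ^ m = (\<Sum>a\<in>A. (a ^ (2 * i + 1)) ^ 2 ^ m)"
      unfolding P_def using char by (intro freshmans_dream_sum') auto
    also have "\<dots> = P A i"
      unfolding P_def
    proof (rule sum.cong)
      fix a assume "a \<in> A"
      then have "a ^ 2 ^ m = a" using that by (auto simp: S_def)
      then show "(a ^ (2 * i + 1)) ^ 2 ^ m = a ^ (2 * i + 1)"
        by (metis power_mult mult.commute)
    qed simp
    finally show ?thesis by (simp add: S_def)
  qed
  have "f A \<in> Y" if "A \<subseteq> S" for A
    unfolding f_def Y_def using P_in[OF that] by (simp add: restrict_PiE_iff)
  then have fY: "f ` Pow S \<subseteq> Y" by blast
  have cY: "?n * card Y = card (Pow S)"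
  proof -
    have "card Y = 2 ^ (1 + m * t)"
      by (simp add: Y_def card_cartesian_product card_PiE card_S power_mult)
    then have "?n * card Y = 2 ^ (2 ^ m - (1 + m * t) + (1 + m * t))" by (simp only: power_add)
    also have "\<dots> = 2 ^ 2 ^ m" using assms(2) by simp
    finally show ?thesis by (simp add: card_Pow fin_S card_S)
  qed
  have Y: "finite Y" "Y \<noteq> {}"
    using fin_S card_S by (auto simp: Y_def finite_PiE PiE_eq_empty_iff)
  have "\<exists>z\<in>Y. ?n \<le> card {A \<in> Pow S. f A = z}"
    by (rule ex_large_fibre[OF _ Y(1) fY _ Y(2)]) (use fin_S cY in auto)
  then obtain z where z: "?n \<le> card {A \<in> Pow S. f A = z}" by blast
  have "cap ?n (2 * t + 2) \<le> ?n * card S"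
  proof (rule cap_le_mult_card)
    fix A B assume "A \<in> {A \<in> Pow S. f A = z}" "B \<in> {A \<in> Pow S. f A = z}" "A \<noteq> B"
    then have AB: "A \<subseteq> S" "B \<subseteq> S" "f A = f B" "A \<noteq> B" by auto
    then have fin: "finite A" "finite B" using fin_S finite_subset by auto
    have "even (card A) = even (card B)" using AB(3) by (simp add: f_def)
    then have ev: "even (card (sym_diff A B))" using fin by (intro even_card_sym_diff) auto
    have "P A i = P B i" if "i < t" for i
    proof -
      have "restrict (P A) {..<t} i = restrict (P B) {..<t} i" using AB(3) by (simp add: f_def)
      then show ?thesis using that by simp
    qed
    then have odd: "(\<Sum>a\<in>sym_diff A B. a ^ (2 * i + 1)) = 0" if "i < t" for i
      using that char fin unfolding P_def by (intro sum_sym_diff_char_2) auto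
    \<comment> \<open>The \<open>2 * t + 1\<close> power sums with exponents \<open>0\<close> to
      \<open>2 * t\<close> vanish on the nonempty symmetric difference.\<close>
    have "2 * t + 1 < card (sym_diff A B)"
      using power_sums_zero_if_odd_power_sums_zero[OF char ev odd] fin AB(4)
      by (intro less_card_if_power_sums_zero) auto
    then show "2 * t + 2 \<le> card (sym_diff A B)" by simp
  qed (use z fin_S in auto)
  then show ?thesis by (simp add: card_S)
qed

text \<open>Needed for odd \<open>l\<close>, since the BCH code yields only even distances
  \<open>2 * t + 2\<close>.\<close>

lemma cap_mono_distance:
  assumes "l \<le> l'"
  shows "cap n l \<le> cap n l'"
proof -
  obtain Hs where Hs: "bipartite_covering n l' Hs" "capacity Hs = cap n l'"
    using cap_attained by blast
  then have "bipartite_covering n l Hs"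
    using assms unfolding bipartite_covering_def by (meson order_trans)
  then show ?thesis
    unfolding cap_def[of n l] using Hs(2) by (intro Least_le) blast
qed

text \<open>The values are \<open>n = 2 ^ r m\<close> for all large \<open>m\<close>, so that
  \<open>log 2 n\<close> is exactly \<open>r m\<close>.\<close>

lemma infinite_cap_le_fixed_distance:
  assumes "l \<ge> 1"
  shows "infinite {n :: nat. n \<ge> 2 \<and>
    real (cap n l) \<le> real n * (log 2 (real n)
      + real_of_int \<lfloor>(real l - 1) / 2\<rfloor> * log 2 (log 2 (real n)) + 2)}"
    (is "infinite {n. n \<ge> 2 \<and> ?P n}")
proof -
  define t where "t = (l - 1) div 2"
  have t: "\<lfloor>(real l - 1) / 2\<rfloor> = int t"
    using assms floor_divide_of_nat_eq[of "l - 1" 2, where 'a = real] by (simp add: t_def of_nat_diff)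
  have lt: "l \<le> 2 * t + 2" using assms by (simp add: t_def)
  define r where "r m = 2 ^ m - (1 + m * t)" for m :: nat
  have ev: "eventually (\<lambda>m. N < 2 ^ r m \<and> 2 \<le> (2 :: nat) ^ r m \<and> ?P (2 ^ r m)) at_top" for N :: nat
  proof -
    \<comment> \<open>This keeps the natural subtraction in \<open>r m\<close> from truncating and
      forces \<open>r m > N\<close>, so \<open>n\<close> is unbounded.\<close>
    have "eventually (\<lambda>m. 1 + real m * real t + real N + 1 \<le> 2 ^ m) at_top" by real_asymp
    then show ?thesis
      using eventually_bch_length[of t] eventually_gt_at_top[of 0]
    proof eventually_elim
      case (elim m)
      have "real (1 + m * t + N + 1) \<le> real (2 ^ m)" using elim(1) by simp
      then have m: "1 + m * t + N + 1 \<le> 2 ^ m" unfolding of_nat_le_iff .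
      then have r: "N < r m" "1 \<le> r m" by (auto simp: r_def)
      have "real (r m) = 2 ^ m - 1 - real m * real t"
        using m by (simp add: r_def of_nat_diff)
      with elim(2) have len: "2 ^ m \<le> real (r m) + real t * log 2 (real (r m)) + 2" by simp
      have "N < 2 ^ r m" using r(1) less_exp[of "r m"] by linarith
      moreover have "(2 :: nat) ^ 1 \<le> 2 ^ r m" using r(2) by (intro power_increasing) auto
      moreover have "?P (2 ^ r m)"
      proof -
        have "cap (2 ^ r m) l \<le> cap (2 ^ r m) (2 * t + 2)" using lt by (rule cap_mono_distance)
        also have "\<dots> \<le> 2 ^ r m * 2 ^ m"
          unfolding r_def using elim(3) m by (intro cap_le_bch) auto
        finally have "real (cap (2 ^ r m) l) \<le> real (2 ^ r m * 2 ^ m)" by (rule of_nat_mono)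
        also have "\<dots> \<le> real (2 ^ r m) * (real (r m) + real t * log 2 (real (r m)) + 2)"
          using len by simp
        finally show ?thesis by (simp add: t log_nat_power)
      qed
      ultimately show ?case by simp
    qed
  qed
  show ?thesis
    unfolding infinite_nat_iff_unbounded
  proof
    fix N :: nat
    obtain m where "N < 2 ^ r m" "2 \<le> (2 :: nat) ^ r m" "?P (2 ^ r m)"
      using eventually_happens[OF ev[of N]] by auto
    then show "\<exists>n>N. n \<in> {n. n \<ge> 2 \<and> ?P n}" by blast
  qed
qed

section \<open>Collecting the estimates\<close>

lemma cap_2_le_ceiling:
  assumes "n \<ge> 2"
  shows "real (cap n 2) \<le> real n * (real_of_int \<lceil>log 2 (real n)\<rceil> + 1)"
proof -
  define r where "r = nat \<lceil>log 2 (real n)\<rceil>"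
  have "log 2 (real n) \<ge> 0" using assms by simp
  then have r: "real r = real_of_int \<lceil>log 2 (real n)\<rceil>" by (simp add: r_def)
  have "real n = 2 powr log 2 (real n)" using assms by simp
  also have "\<dots> \<le> 2 powr real r" unfolding r by (intro powr_mono) auto
  also have "\<dots> = real (2 ^ r)" by (simp add: powr_realpow)
  finally have "n \<le> 2 ^ r" unfolding of_nat_le_iff .
  then have "real (cap n 2) \<le> real (n * (r + 1))" by (intro of_nat_mono cap_2_le)
  then show ?thesis by (simp add: r algebra_simps)
qed

theorem theorem1p2:
  shows "(\<forall>n l :: nat. n \<ge> 2 \<longrightarrow> l \<ge> 1 \<longrightarrow> cap n l \<le> n * min_code_length n l)
    \<and> (\<forall>n :: nat. n \<ge> 2 \<longrightarrow>
          real (cap n 2) \<le> real n * (real_of_int \<lceil>log 2 (real n)\<rceil> + 1)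
        \<and> real n * (real_of_int \<lceil>log 2 (real n)\<rceil> + 1) < real n * (log 2 (real n) + 2))
    \<and> (\<forall>n l :: nat. n \<ge> 2 \<longrightarrow> 2 \<le> l \<longrightarrow> real l \<le> 0.5 * log 2 (real n) \<longrightarrow>
          real (cap n l) \<le> real n * (log 2 (real n)
            + (real l - 1) * (log 2 (log 2 (real n) / (real l - 1)) + 4)))
    \<and> (\<forall>(c :: real) (n :: nat) (l :: nat). 0 < c \<longrightarrow> c < 1/2 \<longrightarrow> n \<ge> 2 \<longrightarrow> l \<ge> 1 \<longrightarrow>
          real l \<ge> c * (log 2 (real n) / (1 - binary_entropy c)) \<longrightarrow>
          real (cap n l) \<le> (real l / c) * real n)
    \<and> (\<forall>l :: nat. l \<ge> 1 \<longrightarrow>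
          infinite {n :: nat. n \<ge> 2 \<and>
            real (cap n l) \<le> real n * (log 2 (real n)
              + real_of_int \<lfloor>(real l - 1) / 2\<rfloor> * log 2 (log 2 (real n)) + 2)})"
proof (intro conjI allI impI)
  show "real n * (real_of_int \<lceil>log 2 (real n)\<rceil> + 1) < real n * (log 2 (real n) + 2)"
    if "n \<ge> 2" for n :: nat
    using that ceiling_correct[of "log 2 (real n)"] by (intro mult_strict_left_mono) auto
qed (use cap_le_mult_min_code_length cap_2_le_ceiling cap_le_small_distance cap_le_large_distance
    infinite_cap_le_fixed_distance in blast)+

end
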